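(* Let $\mathscr{C}$ be a finite fuzzy covering on $\mathbb{U}$ and $O$ an overlap function. Let $N_2^{\mathscr{C}}$ and $N_2^{\mathscr{C}_1}$ be the fuzzy neighborhood operators defined by $O$ from the coverings $\mathscr{C}$ and $\mathscr{C}_1$. Then $N_2^{\mathscr{C}}=N_2^{\mathscr{C}_1}$.
   Context: $\mathbb{U}$ is a non-empty set; fuzzy subsets of $\mathbb{U}$ are maps $\mathbb{U}\to[0,1]$; inclusion is pointwise $\le$. Suprema are taken in $[0,1]$. A fuzzy covering on $\mathbb{U}$ is a collection $\mathscr{C}$ of fuzzy subsets of $\mathbb{U}$, none identically $0$, such that for every $x\in\mathbb{U}$ there is $K\in\mathscr{C}$ with $K(x)=1$. For a collection $\mathscr{D}$ of fuzzy sets and $x\in\mathbb{U}$: $\mathbb{C}(\mathscr{D},x)=\{K\in\mathscr{D}:K(x)>0\}$; $md(\mathscr{D},x)=\{K\in\mathbb{C}(\mathscr{D},x):\forall S\in\mathbb{C}(\mathscr{D},x),\ (S(x)=K(x)\text{ and }S\subseteq K)\Rightarrow S=K\}$. The derived covering $\mathscr{C}_1$ is $\mathscr{C}_1=\bigcup\{md(\mathscr{C},x):x\in\mathbb{U}\}$. An overlap function is a map $O:[0,1]^2\to[0,1]$ that is commutative, increasing (non-decreasing in each argument), continuous, and satisfies $O(x,y)=0\iff xy=0$ and $O(x,y)=1\iff xy=1$. For $x,y\in\mathbb{U}$: $N_2^{\mathscr{D}}(x)(y)=\sup_{K\in md(\mathscr{D},x)}O(K(x),K(y))$. Equality of operators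 means equality of $N(x)(y)$ for all $x,y\in\mathbb{U}$. *)

theory Defs
  imports "HOL-Analysis.Analysis"
begin

text \<open>The universe is the type \<^typ>\<open>'a\<close>, which like every type is non-empty. Fuzzy sets
  are functions into the reals with values in the unit interval, and inclusion of fuzzy sets
  is the library's pointwise order on functions.\<close>

type_synonym 'a fuzzy = "'a \<Rightarrow> real"

definition fuzzy_set :: "'a fuzzy \<Rightarrow> bool" where
  "fuzzy_set K \<longleftrightarrow> (\<forall>x. K x \<in> {0..1})"

definition fuzzy_covering :: "'a fuzzy set \<Rightarrow> bool" where
  "fuzzy_covering C \<longleftrightarrow>
     (\<forall>K\<in>C. fuzzy_set K \<and> K \<noteq> (\<lambda>x. 0)) \<and> (\<forall>x. \<exists>K\<in>C. K x = 1)"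

definition nbhd_system :: "'a fuzzy set \<Rightarrow> 'a \<Rightarrow> 'a fuzzy set" where
  "nbhd_system D x = {K \<in> D. K x > 0}"

definition md :: "'a fuzzy set \<Rightarrow> 'a \<Rightarrow> 'a fuzzy set" where
  "md D x = {K \<in> nbhd_system D x. \<forall>S \<in> nbhd_system D x. S x = K x \<and> S \<le> K \<longrightarrow> S = K}"

definition derived_covering :: "'a fuzzy set \<Rightarrow> 'a fuzzy set" where
  "derived_covering C = (\<Union>x. md C x)"

text \<open>Only the values of an overlap function on the unit square are constrained or used.\<close>

definition overlap_function :: "(real \<Rightarrow> real \<Rightarrow> real) \<Rightarrow> bool" where
  "overlap_function Ov \<longleftrightarrow>
     (\<forall>x\<in>{0..1}. \<forall>y\<in>{0..1}. Ov x y \<in> {0..1}) \<and>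
     (\<forall>x\<in>{0..1}. \<forall>y\<in>{0..1}. Ov x y = Ov y x) \<and>
     (\<forall>x\<in>{0..1}. mono_on {0..1} (\<lambda>y. Ov x y)) \<and>
     (\<forall>y\<in>{0..1}. mono_on {0..1} (\<lambda>x. Ov x y)) \<and>
     continuous_on ({0..1} \<times> {0..1}) (\<lambda>(x, y). Ov x y) \<and>
     (\<forall>x\<in>{0..1}. \<forall>y\<in>{0..1}. Ov x y = 0 \<longleftrightarrow> x * y = 0) \<and>
     (\<forall>x\<in>{0..1}. \<forall>y\<in>{0..1}. Ov x y = 1 \<longleftrightarrow> x * y = 1)"

text \<open>Supremum in the lattice $[0,1]$. Inserting the bottom element 0 only matters for the
  empty set, whose supremum in $[0,1]$ is 0 but is unspecified for the reals.\<close>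

definition unit_Sup :: "real set \<Rightarrow> real" where
  "unit_Sup A = Sup (insert 0 A)"

definition N2 :: "(real \<Rightarrow> real \<Rightarrow> real) \<Rightarrow> 'a fuzzy set \<Rightarrow> 'a \<Rightarrow> 'a fuzzy" where
  "N2 Ov D x y = unit_Sup ((\<lambda>K. Ov (K x) (K y)) ` md D x)"

end

theory Submission
  imports Defs
begin

text \<open>\<open>N2\<close> sees a covering only through \<open>md\<close> at each point, so it
  suffices that \<open>C\<close> and its derived covering have the same \<open>md\<close> at every
  \<open>x\<close>. The derived covering is a subcollection of \<open>C\<close> that retains each
  \<open>md C x\<close>, so minimality in \<open>C\<close> survives. Conversely, finiteness
  (\<open>md_below\<close>) gives every member of \<open>C\<close> positive at \<open>x\<close> a
  minimal one below it with the same value at \<open>x\<close>; this one is retained, so nothing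
  else can be minimal in the derived covering.\<close>

lemma md_below:
  assumes "finite C" and "S \<in> nbhd_system C x"
  obtains T where "T \<in> md C x" and "T x = S x" and "T \<le> S"
proof -
  \<comment> \<open>\<open>md\<close> compares only sets with equal value at \<open>x\<close>, so an
    ordinary minimal element of this class already lies in \<open>md C x\<close>.\<close>
  let ?A = "{T \<in> nbhd_system C x. T x = S x}"
  have "finite ?A"
    using assms(1) by (simp add: nbhd_system_def)
  moreover have "S \<in> ?A"
    using assms(2) by simp
  ultimately obtain T where T: "T \<in> ?A" "T \<le> S" "\<And>U. U \<in> ?A \<Longrightarrow> U \<le> T \<Longrightarrow> T = U"
    using finite_has_minimal2[of ?A S] by blast
  then have "T \<in> md C x"
    by (auto simp: md_def)
  with T that show thesis by auto
qed

lemma md_derived_covering: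
  assumes "finite C"
  shows "md (derived_covering C) x = md C x"
proof
  have sub: "nbhd_system (derived_covering C) x \<subseteq> nbhd_system C x"
    by (auto simp: derived_covering_def md_def nbhd_system_def)
  have md_sub: "md C x \<subseteq> nbhd_system (derived_covering C) x"
    by (auto simp: derived_covering_def md_def nbhd_system_def)
  show "md C x \<subseteq> md (derived_covering C) x"
  proof
    fix K assume K: "K \<in> md C x"
    \<comment> \<open>Each competitor \<open>S\<close> of \<open>K\<close> in the derived covering
      is one in \<open>C\<close>, by \<open>sub\<close>.\<close>
    have "S = K"
      if "S \<in> nbhd_system (derived_covering C) x" and "S x = K x" and "S \<le> K" for S
      using K sub that by (auto simp: md_def)
    with K md_sub show "K \<in> md (derived_covering C) x"
      by (auto simp: md_def)
  qed
  show "md (derived_covering C) x \<subseteq> md C x"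
  proof
    fix K assume K: "K \<in> md (derived_covering C) x"
    then have "K \<in> nbhd_system C x"
      using sub by (auto simp: md_def)
    then obtain T where T: "T \<in> md C x" "T x = K x" "T \<le> K"
      using md_below[OF assms] by blast
    \<comment> \<open>\<open>T\<close> lies in the derived covering by \<open>md_sub\<close>, so
      minimality of \<open>K\<close> there applies to it.\<close>
    then have "T = K"
      using K md_sub by (auto simp: md_def)
    with T show "K \<in> md C x" by simp
  qed
qed

theorem proposition4p2:
  fixes C :: "'a fuzzy set" and Ov :: "real \<Rightarrow> real \<Rightarrow> real"
  assumes "finite C" and "fuzzy_covering C" and "overlap_function Ov"
  shows "N2 Ov C = N2 Ov (derived_covering C)"
  by (intro ext) (simp only: N2_def md_derived_covering[OF assms(1)])

end
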